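(* Let $\Gamma$ be a discrete group and let $\pi$ be a unitary representation of $\Gamma$ such that the $C^*$-algebra $\mathcal{B}_\pi$ is commutative. Then any extendable trace $\tau$ on $C^*_\pi(\Gamma)$ is supported on $\mathrm{Rad}_\pi(\Gamma)$, i.e. $\tau(\pi(g))=0$ for every $g\in\Gamma\setminus\mathrm{Rad}_\pi(\Gamma)$.
   Context: For a unitary representation $\pi:\Gamma\to\mathcal{U}(\mathcal{H}_\pi)$, $\Gamma$ acts on $B(\mathcal{H}_\pi)$ by $g\cdot x=\pi(g)x\pi(g^{-1})$. A $\Gamma$-map between operator systems carrying $\Gamma$-actions is a unital completely positive $\Gamma$-equivariant linear map. Furstenberg--Hamana (FH) boundary: on the set $\mathcal{G}$ of all $\Gamma$-maps $\phi:B(\mathcal{H}_\pi)\to B(\mathcal{H}_\pi)$ put the preorder $\phi\le\psi$ iff $\|\phi(x)\|\le\|\psi(x)\|$ for all $x$. Then $\mathcal{G}$ has minimal elements, every minimal element is idempotent, and its image is unique up to bijective completely isometric $\Gamma$-maps. $\mathcal{B}_\pi$ is the image of a minimal $\phi\in\mathcal{G}$, with the Choi--Effros product $a\cdot b=\phi(ab)$ and the restricted $\Gamma$-action; it is a $\Gamma$-$C^*$-algebra. $\mathrm{Rad}_\pi(\Gamma)$ (the $\pi$-amenable radical) is the kernel of the action $\Gamma\curvearrowright\mathcal{B}_\pi$. $C^*_\pi(\Gamma)\subseteq B(\mathcal{H}_\pi)$ is the norm-closed span of $\pi(\Gamma)$. A trace is a state $\tau$ with $\tau(ab)=\tau(ba)$.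 A trace $\tau$ on $C^*_\pi(\Gamma)$ is extendable if, regarded as a map $C^*_\pi(\Gamma)\to\mathbb{C}1\subseteq\mathcal{B}_\pi$, it extends to a $\Gamma$-map $B(\mathcal{H}_\pi)\to\mathcal{B}_\pi$. *)

theory Defs
  imports "HOL-Analysis.Analysis" "HOL-Algebra.Group"
begin

text \<open>Complex Hilbert spaces, with the inner product linear in the first argument.\<close>

class complex_hilbert = banach +
  fixes scaleC :: "complex \<Rightarrow> 'a \<Rightarrow> 'a"  (infixr "*\<^sub>C" 75)
    and cinner :: "'a \<Rightarrow> 'a \<Rightarrow> complex"
  assumes scaleC_add_right: "c *\<^sub>C (x + y) = c *\<^sub>C x + c *\<^sub>C y"
    and scaleC_add_left: "(c + d) *\<^sub>C x = c *\<^sub>C x + d *\<^sub>C x"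
    and scaleC_scaleC: "c *\<^sub>C (d *\<^sub>C x) = (c * d) *\<^sub>C x"
    and scaleC_of_real: "complex_of_real r *\<^sub>C x = r *\<^sub>R x"
    and cinner_add_left: "cinner (x + y) z = cinner x z + cinner y z"
    and cinner_scaleC_left: "cinner (c *\<^sub>C x) y = c * cinner x y"
    and cinner_commute: "cinner x y = cnj (cinner y x)"
    and cinner_self: "cinner x x = complex_of_real ((norm x)\<^sup>2)"
begin

lemma cinner_scaleC_right: "cinner x (c *\<^sub>C y) = cnj c * cinner x y"
  by (metis cinner_commute cinner_scaleC_left complex_cnj_mult)

lemma norm_scaleC: "norm (c *\<^sub>C x) = cmod c * norm x"
proof -
  have "complex_of_real ((norm (c *\<^sub>C x))\<^sup>2) = cinner (c *\<^sub>C x) (c *\<^sub>C x)"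
    by (rule cinner_self[symmetric])
  also have "\<dots> = (c * cnj c) * cinner x x"
    by (simp only: cinner_scaleC_left cinner_scaleC_right mult_ac)
  also have "\<dots> = complex_of_real ((cmod c * norm x)\<^sup>2)"
    by (simp only: cinner_self complex_norm_square[symmetric] power_mult_distrib of_real_mult)
  finally have "(norm (c *\<^sub>C x))\<^sup>2 = (cmod c * norm x)\<^sup>2"
    using of_real_eq_iff by blast
  then show ?thesis
    by (simp add: power2_eq_iff_nonneg)
qed

end

text \<open>The type \<open>'h \<Rightarrow>\<^sub>L 'h\<close> consists of the bounded real-linear operators, with the operator
  norm; \<open>B(H)\<close> is its subset of complex-linear operators.\<close>

definition bounded_ops :: "('h::complex_hilbert \<Rightarrow>\<^sub>L 'h) set" where
  "bounded_ops = {T. \<forall>c x. blinfun_apply T (c *\<^sub>C x) = c *\<^sub>C blinfun_apply T x}"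

lift_definition scale_op :: "complex \<Rightarrow> ('h::complex_hilbert \<Rightarrow>\<^sub>L 'h) \<Rightarrow> ('h \<Rightarrow>\<^sub>L 'h)"
  is "\<lambda>c T x. c *\<^sub>C T x"
proof -
  fix c :: complex and T :: "'h \<Rightarrow> 'h"
  assume "bounded_linear T"
  moreover have "bounded_linear (\<lambda>x::'h. c *\<^sub>C x)"
  proof (rule bounded_linear_intro[where K = "cmod c"])
    fix r :: real and x :: 'h
    show "c *\<^sub>C (r *\<^sub>R x) = r *\<^sub>R (c *\<^sub>C x)"
      by (simp add: scaleC_of_real[symmetric] scaleC_scaleC mult.commute)
  qed (simp_all add: scaleC_add_right norm_scaleC mult.commute)
  ultimately show "bounded_linear (\<lambda>x. c *\<^sub>C T x)"
    by (rule bounded_linear_compose[rotated])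
qed

lemma module_scale_op: "module (scale_op :: complex \<Rightarrow> ('h::complex_hilbert \<Rightarrow>\<^sub>L 'h) \<Rightarrow> _)"
proof
  fix a b :: complex and x y :: "'h \<Rightarrow>\<^sub>L 'h"
  show "scale_op a (x + y) = scale_op a x + scale_op a y"
    by transfer (simp add: scaleC_add_right)
  show "scale_op (a + b) x = scale_op a x + scale_op b x"
    by transfer (simp add: scaleC_add_left)
  show "scale_op a (scale_op b x) = scale_op (a * b) x"
    by transfer (simp add: scaleC_scaleC)
  show "scale_op 1 x = x"
    by (rule blinfun_eqI) (use scaleC_of_real[of 1] in \<open>simp add: scale_op.rep_eq\<close>)
qed

definition unitary_group :: "('h::complex_hilbert \<Rightarrow>\<^sub>L 'h) monoid" where
  "unitary_group = \<lparr>carrier = {U \<in> bounded_ops. surj (blinfun_apply U) \<and>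
       (\<forall>x y. cinner (blinfun_apply U x) (blinfun_apply U y) = cinner x y)},
     monoid.mult = (o\<^sub>L), one = id_blinfun\<rparr>"

text \<open>Positivity of the matrix \<open>[a i j]\<close>, \<open>i, j < n\<close>, as an operator on the \<open>n\<close>-fold direct sum
  of \<open>H\<close>, i.e. as an element of \<open>M\<^sub>n(B(H)) = B(H\<^sup>n)\<close>.\<close>

definition pos_matrix :: "nat \<Rightarrow> (nat \<Rightarrow> nat \<Rightarrow> ('h::complex_hilbert \<Rightarrow>\<^sub>L 'h)) \<Rightarrow> bool" where
  "pos_matrix n a \<longleftrightarrow>
     (\<forall>\<xi>. (\<Sum>i<n. \<Sum>j<n. cinner (blinfun_apply (a i j) (\<xi> j)) (\<xi> i)) \<in> \<real>\<^sub>\<ge>\<^sub>0)"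

definition pos_op :: "('h::complex_hilbert \<Rightarrow>\<^sub>L 'h) \<Rightarrow> bool" where
  "pos_op T \<longleftrightarrow> (\<forall>x. cinner (blinfun_apply T x) x \<in> \<real>\<^sub>\<ge>\<^sub>0)"

definition completely_positive_on ::
  "('h::complex_hilbert \<Rightarrow>\<^sub>L 'h) set \<Rightarrow> (('h \<Rightarrow>\<^sub>L 'h) \<Rightarrow> ('h \<Rightarrow>\<^sub>L 'h)) \<Rightarrow> bool" where
  "completely_positive_on S \<phi> \<longleftrightarrow>
     (\<forall>n a. (\<forall>i<n. \<forall>j<n. a i j \<in> S) \<longrightarrow> pos_matrix n a \<longrightarrow> pos_matrix n (\<lambda>i j. \<phi> (a i j)))"

definition conj_action ::
  "('g, 'm) monoid_scheme \<Rightarrow> ('g \<Rightarrow> ('h::complex_hilbert \<Rightarrow>\<^sub>L 'h)) \<Rightarrow> 'g \<Rightarrow> ('h \<Rightarrow>\<^sub>L 'h) \<Rightarrow> ('h \<Rightarrow>\<^sub>L 'h)" where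
  "conj_action G \<pi> g x = \<pi> g o\<^sub>L x o\<^sub>L \<pi> (inv\<^bsub>G\<^esub> g)"

text \<open>\<open>\<Gamma>\<close>-maps between \<open>\<Gamma>\<close>-invariant operator systems \<open>S, T \<subseteq> B(H)\<close>, with the matrix orders
  inherited from \<open>B(H)\<close>.  Maps are total functions of which only the values on \<open>S\<close> matter.\<close>

definition gamma_map ::
  "('g, 'm) monoid_scheme \<Rightarrow> ('g \<Rightarrow> ('h::complex_hilbert \<Rightarrow>\<^sub>L 'h)) \<Rightarrow>
   ('h \<Rightarrow>\<^sub>L 'h) set \<Rightarrow> ('h \<Rightarrow>\<^sub>L 'h) set \<Rightarrow> (('h \<Rightarrow>\<^sub>L 'h) \<Rightarrow> ('h \<Rightarrow>\<^sub>L 'h)) \<Rightarrow> bool" where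
  "gamma_map G \<pi> S T \<phi> \<longleftrightarrow>
     \<phi> ` S \<subseteq> T \<and>
     (\<forall>x\<in>S. \<forall>y\<in>S. \<phi> (x + y) = \<phi> x + \<phi> y) \<and>
     (\<forall>c. \<forall>x\<in>S. \<phi> (scale_op c x) = scale_op c (\<phi> x)) \<and>
     \<phi> id_blinfun = id_blinfun \<and>
     completely_positive_on S \<phi> \<and>
     (\<forall>g\<in>carrier G. \<forall>x\<in>S. \<phi> (conj_action G \<pi> g x) = conj_action G \<pi> g (\<phi> x))"

definition map_le ::
  "(('h::complex_hilbert \<Rightarrow>\<^sub>L 'h) \<Rightarrow> ('h \<Rightarrow>\<^sub>L 'h)) \<Rightarrow> (('h \<Rightarrow>\<^sub>L 'h) \<Rightarrow> ('h \<Rightarrow>\<^sub>L 'h)) \<Rightarrow> bool" where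
  "map_le \<phi> \<psi> \<longleftrightarrow> (\<forall>x\<in>bounded_ops. norm (\<phi> x) \<le> norm (\<psi> x))"

definition minimal_gamma_map ::
  "('g, 'm) monoid_scheme \<Rightarrow> ('g \<Rightarrow> ('h::complex_hilbert \<Rightarrow>\<^sub>L 'h)) \<Rightarrow>
   (('h \<Rightarrow>\<^sub>L 'h) \<Rightarrow> ('h \<Rightarrow>\<^sub>L 'h)) \<Rightarrow> bool" where
  "minimal_gamma_map G \<pi> \<phi> \<longleftrightarrow>
     gamma_map G \<pi> bounded_ops bounded_ops \<phi> \<and>
     (\<forall>\<psi>. gamma_map G \<pi> bounded_ops bounded_ops \<psi> \<longrightarrow> map_le \<psi> \<phi> \<longrightarrow> map_le \<phi> \<psi>)"

text \<open>The Furstenberg--Hamana boundary is determined only up to isomorphism, by the choice of a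
  minimal \<open>\<Gamma>\<close>-map \<open>\<phi>\<close>; the notions below that depend on it take \<open>\<phi>\<close> as an argument.\<close>

definition fh_boundary ::
  "(('h::complex_hilbert \<Rightarrow>\<^sub>L 'h) \<Rightarrow> ('h \<Rightarrow>\<^sub>L 'h)) \<Rightarrow> ('h \<Rightarrow>\<^sub>L 'h) set" where
  "fh_boundary \<phi> = \<phi> ` bounded_ops"

definition choi_effros ::
  "(('h::complex_hilbert \<Rightarrow>\<^sub>L 'h) \<Rightarrow> ('h \<Rightarrow>\<^sub>L 'h)) \<Rightarrow> ('h \<Rightarrow>\<^sub>L 'h) \<Rightarrow> ('h \<Rightarrow>\<^sub>L 'h) \<Rightarrow> ('h \<Rightarrow>\<^sub>L 'h)" where
  "choi_effros \<phi> a b = \<phi> (a o\<^sub>L b)"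

definition fh_commutative :: "(('h::complex_hilbert \<Rightarrow>\<^sub>L 'h) \<Rightarrow> ('h \<Rightarrow>\<^sub>L 'h)) \<Rightarrow> bool" where
  "fh_commutative \<phi> \<longleftrightarrow>
     (\<forall>a\<in>fh_boundary \<phi>. \<forall>b\<in>fh_boundary \<phi>. choi_effros \<phi> a b = choi_effros \<phi> b a)"

definition amenable_radical ::
  "('g, 'm) monoid_scheme \<Rightarrow> ('g \<Rightarrow> ('h::complex_hilbert \<Rightarrow>\<^sub>L 'h)) \<Rightarrow>
   (('h \<Rightarrow>\<^sub>L 'h) \<Rightarrow> ('h \<Rightarrow>\<^sub>L 'h)) \<Rightarrow> 'g set" where
  "amenable_radical G \<pi> \<phi> = {g \<in> carrier G. \<forall>b\<in>fh_boundary \<phi>. conj_action G \<pi> g b = b}"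

definition cstar_rep ::
  "('g, 'm) monoid_scheme \<Rightarrow> ('g \<Rightarrow> ('h::complex_hilbert \<Rightarrow>\<^sub>L 'h)) \<Rightarrow> ('h \<Rightarrow>\<^sub>L 'h) set" where
  "cstar_rep G \<pi> = closure (module.span scale_op (\<pi> ` carrier G))"

text \<open>States and traces on a unital \<open>C\<^sup>*\<close>-subalgebra \<open>A\<close> of \<open>B(H)\<close>.\<close>

definition state_on ::
  "('h::complex_hilbert \<Rightarrow>\<^sub>L 'h) set \<Rightarrow> (('h \<Rightarrow>\<^sub>L 'h) \<Rightarrow> complex) \<Rightarrow> bool" where
  "state_on A \<tau> \<longleftrightarrow>
     (\<forall>a\<in>A. \<forall>b\<in>A. \<tau> (a + b) = \<tau> a + \<tau> b) \<and>
     (\<forall>c. \<forall>a\<in>A. \<tau> (scale_op c a) = c * \<tau> a) \<and>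
     (\<forall>a\<in>A. pos_op a \<longrightarrow> \<tau> a \<in> \<real>\<^sub>\<ge>\<^sub>0) \<and>
     \<tau> id_blinfun = 1"

definition trace_on ::
  "('h::complex_hilbert \<Rightarrow>\<^sub>L 'h) set \<Rightarrow> (('h \<Rightarrow>\<^sub>L 'h) \<Rightarrow> complex) \<Rightarrow> bool" where
  "trace_on A \<tau> \<longleftrightarrow> state_on A \<tau> \<and> (\<forall>a\<in>A. \<forall>b\<in>A. \<tau> (a o\<^sub>L b) = \<tau> (b o\<^sub>L a))"

definition extendable ::
  "('g, 'm) monoid_scheme \<Rightarrow> ('g \<Rightarrow> ('h::complex_hilbert \<Rightarrow>\<^sub>L 'h)) \<Rightarrow>
   (('h \<Rightarrow>\<^sub>L 'h) \<Rightarrow> ('h \<Rightarrow>\<^sub>L 'h)) \<Rightarrow> (('h \<Rightarrow>\<^sub>L 'h) \<Rightarrow> complex) \<Rightarrow> bool" where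
  "extendable G \<pi> \<phi> \<tau> \<longleftrightarrow>
     (\<exists>\<Phi>. gamma_map G \<pi> bounded_ops (fh_boundary \<phi>) \<Phi> \<and>
          (\<forall>a\<in>cstar_rep G \<pi>. \<Phi> a = scale_op (\<tau> a) id_blinfun))"

end

theory Submission
  imports Defs
begin

text \<open>Let \<open>\<Phi> : B(H) \<rightarrow> B\<^sub>\<pi>\<close> be a \<open>\<Gamma>\<close>-map that extends \<open>\<tau>\<close>, and put \<open>u = \<pi>(g)\<close>, so that
  \<open>\<Phi>(u) = \<tau>(u) 1\<close>.

  The boundary is rigid: \<open>\<Phi>\<close> restricts to the identity on \<open>B\<^sub>\<pi>\<close>
  (\<open>gamma_map_to_boundary_fixes_boundary\<close>).  Indeed the averages
  \<open>(1/n) (\<phi> + \<Phi>\<phi> + \<dots> + \<Phi>\<^sup>n\<^sup>-\<^sup>1\<phi>)\<close> are \<open>\<Gamma>\<close>-maps below the minimal map \<open>\<phi>\<close>, hence have the same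
  norms as \<open>\<phi>\<close>, whereas on \<open>y = \<Phi>(b) - b\<close> with \<open>b \<in> B\<^sub>\<pi>\<close> they telescope and tend to \<open>0\<close>
  (\<open>minimal_gamma_map_coboundary\<close>).  That \<open>\<phi>\<close> itself is
  idempotent follows in the same way, with \<open>\<Phi> = \<phi>\<close>.

  So \<open>\<Phi>\<close> is an idempotent unital completely positive map with image \<open>B\<^sub>\<pi>\<close>.  As in the theorem of
  Choi and Effros, \<open>\<Phi>(b w) = \<Phi>(w b) = 0\<close> whenever \<open>b \<in> B\<^sub>\<pi>\<close> and \<open>\<Phi>(w) = 0\<close>
  (\<open>idempotent_gamma_map_right_kernel\<close> and \<open>idempotent_gamma_map_left_kernel\<close>).  For
  \<open>w = u - \<tau>(u) 1\<close> this says \<open>\<Phi>(b u) = \<tau>(u) b = \<Phi>(u b)\<close> for all \<open>b \<in> B\<^sub>\<pi>\<close>.  Since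
  \<open>u b = (g \<cdot> b) u\<close> and \<open>g \<cdot> b \<in> B\<^sub>\<pi>\<close>, it follows that \<open>\<tau>(u) b = \<tau>(u) (g \<cdot> b)\<close>; hence
  \<open>\<tau>(\<pi>(g)) \<noteq> 0\<close> forces \<open>g\<close> to act trivially on \<open>B\<^sub>\<pi>\<close>.

  Both the contractivity of \<open>\<Gamma>\<close>-maps, which bounds the telescoped averages, and the vanishing of
  \<open>\<Phi>(b w)\<close> rest on the Schwarz inequality \<open>gamma_map_schwarz\<close>; the adjoints in it are obtained
  from the Riesz representation theorem.\<close>

section \<open>The inner product\<close>

lemma cinner_add_right: "cinner x (y + z) = cinner x y + cinner x (z::'h::complex_hilbert)"
  by (metis cinner_add_left cinner_commute complex_cnj_add)

lemma scaleC_minus1: "(-1) *\<^sub>C x = - (x::'h::complex_hilbert)"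
  using scaleC_of_real[of "-1" x] by simp

lemma scaleC_one [simp]: "1 *\<^sub>C x = (x::'h::complex_hilbert)"
  using scaleC_of_real[of 1 x] by simp

lemma scaleC_0 [simp]: "c *\<^sub>C (0::'h::complex_hilbert) = 0"
  using scaleC_add_right[of c "0::'h" 0] by simp

lemma cinner_minus_left: "cinner (- x) y = - cinner x (y::'h::complex_hilbert)"
  using cinner_scaleC_left[of "-1" x y] by (simp add: scaleC_minus1)

lemma cinner_minus_right: "cinner x (- y) = - cinner x (y::'h::complex_hilbert)"
  using cinner_scaleC_right[of x "-1" y] by (simp add: scaleC_minus1)

lemma cinner_diff_left: "cinner (x - y) z = cinner x z - cinner y (z::'h::complex_hilbert)"
  using cinner_add_left[of x "- y" z] by (simp add: cinner_minus_left)

lemma cinner_diff_right: "cinner x (y - z) = cinner x y - cinner x (z::'h::complex_hilbert)"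
  using cinner_add_right[of x y "- z"] by (simp add: cinner_minus_right)

lemma cinner_0_left [simp]: "cinner 0 (y::'h::complex_hilbert) = 0"
  using cinner_add_left[of 0 0 y] by simp

lemma cinner_0_right [simp]: "cinner (y::'h::complex_hilbert) 0 = 0"
  using cinner_add_right[of y 0 0] by simp

lemma cinner_scaleR_left: "cinner (r *\<^sub>R x) y = of_real r * cinner x (y::'h::complex_hilbert)"
  by (metis cinner_scaleC_left scaleC_of_real)

lemma cinner_scaleR_right: "cinner x (r *\<^sub>R y) = of_real r * cinner x (y::'h::complex_hilbert)"
  by (metis cinner_scaleC_right complex_cnj_complex_of_real scaleC_of_real)

lemmas cinner_linear = cinner_add_left cinner_add_right cinner_diff_left cinner_diff_right
  cinner_minus_left cinner_minus_right cinner_scaleC_left cinner_scaleC_right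
  cinner_scaleR_left cinner_scaleR_right

lemma Re_cinner_commute: "Re (cinner x y) = Re (cinner y (x::'h::complex_hilbert))"
  by (subst cinner_commute) simp

lemma Re_cinner_self: "Re (cinner x x) = (norm (x::'h::complex_hilbert))\<^sup>2"
  by (simp add: cinner_self)

lemma norm_add_square:
  "(norm (x + y))\<^sup>2 = (norm x)\<^sup>2 + 2 * Re (cinner x y) + (norm (y::'h::complex_hilbert))\<^sup>2"
proof -
  have "(norm (x + y))\<^sup>2 = Re (cinner (x + y) (x + y))"
    by (simp add: Re_cinner_self)
  also have "\<dots> = (norm x)\<^sup>2 + 2 * Re (cinner x y) + (norm y)\<^sup>2"
    using Re_cinner_commute[of y x] by (simp add: cinner_add_left cinner_add_right Re_cinner_self)
  finally show ?thesis .
qed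

lemma Re_cinner_bound: "\<bar>Re (cinner x y)\<bar> \<le> norm x * norm (y::'h::complex_hilbert)"
proof -
  have le: "Re (cinner u y) \<le> norm u * norm y" for u
  proof -
    have "(norm (u + y))\<^sup>2 \<le> (norm u + norm y)\<^sup>2"
      by (simp add: norm_triangle_ineq power_mono)
    then show ?thesis
      by (simp add: norm_add_square power2_sum)
  qed
  show ?thesis
    using le[of x] le[of "- x"] by (simp add: cinner_minus_left)
qed

lemma eq_0_if_quadratic_nonneg:
  fixes a b :: real
  assumes "\<And>t. 0 \<le> 2 * t * a + t\<^sup>2 * b"
  shows "a = 0"
proof -
  \<comment> \<open>At \<open>t = - s a\<close> the form equals \<open>s a\<^sup>2 (s b - 2)\<close>, with \<open>s > 0\<close> and \<open>s b < 2\<close>.\<close>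
  define s where "s = 1 / (\<bar>b\<bar> + 1)"
  have s: "s > 0" "s * \<bar>b\<bar> < 1"
    by (simp_all add: s_def)
  have "0 \<le> 2 * (- (s * a)) * a + (- (s * a))\<^sup>2 * b"
    by (rule assms)
  also have "\<dots> = s * a\<^sup>2 * (s * b - 2)"
    by (simp add: power2_eq_square algebra_simps)
  finally have "0 \<le> s * a\<^sup>2 * (s * b - 2)" .
  moreover have "s * b - 2 < 0"
    using s mult_left_mono[of b "\<bar>b\<bar>" s] by linarith
  ultimately show ?thesis
    using s by (smt (verit) mult_pos_neg zero_less_mult_iff zero_less_power2)
qed

lemma cinner_ext:
  assumes "\<And>z. cinner z x = cinner z (y::'h::complex_hilbert)"
  shows "x = y"
proof -
  have "(norm (x - y))\<^sup>2 = Re (cinner (x - y) (x - y))"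
    by (simp add: Re_cinner_self)
  also have "\<dots> = 0"
    by (simp add: cinner_diff_right assms)
  finally show ?thesis by simp
qed


section \<open>Adjoints\<close>

text \<open>The Riesz representation theorem, by minimising \<open>\<parallel>x\<parallel>\<^sup>2 - 2 f x\<close>: the parallelogram law makes
  every minimising sequence Cauchy, and the first variation at the minimiser is the claim.\<close>

lemma riesz_representation_Re:
  fixes f :: "'h::complex_hilbert \<Rightarrow> real"
  assumes f: "bounded_linear f"
  shows "\<exists>y. \<forall>x. f x = Re (cinner x y)"
proof -
  interpret f: bounded_linear f by (rule f)
  obtain K where K: "\<And>x. norm (f x) \<le> norm x * K"
    using f.bounded by blast
  define J where "J = (\<lambda>x. (norm x)\<^sup>2 - 2 * f x)"
  have lower: "- K\<^sup>2 \<le> J x" for x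
  proof -
    have "f x \<le> norm x * K"
      using K[of x] by simp
    moreover have "0 \<le> (norm x - K)\<^sup>2" by simp
    ultimately show ?thesis
      by (simp add: J_def power2_diff)
  qed
  have bdd: "bdd_below (range J)"
    using lower by (intro bdd_belowI[of _ "- K\<^sup>2"]) auto
  define m where "m = Inf (range J)"
  have m_le: "m \<le> J x" for x
    unfolding m_def using bdd by (intro cInf_lower) auto
  have "\<exists>x. J x < m + inverse (real (Suc n))" for n
    using cInf_lessD[of "range J" "m + inverse (real (Suc n))"] by (auto simp: m_def)
  then obtain X where X: "\<And>n. J (X n) < m + inverse (real (Suc n))"
    by metis
  have par: "(norm (a - b))\<^sup>2 = 2 * J a + 2 * J b - 4 * J ((1/2) *\<^sub>R (a + b))" for a b
  proof -
    have "4 * J ((1/2) *\<^sub>R (a + b)) = (norm (a + b))\<^sup>2 - 4 * f (a + b)"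
      by (simp add: J_def f.scaleR power_divide del: norm_scaleR)
         (simp add: power_divide)
    then show ?thesis
      using norm_add_square[of a b] norm_add_square[of a "- b"]
      by (simp add: J_def f.add cinner_minus_right)
  qed
  have close: "(norm (X i - X j))\<^sup>2 \<le> 4 * inverse (real (Suc N))" if "N \<le> i" "N \<le> j" for i j N
  proof -
    have "inverse (real (Suc i)) \<le> inverse (real (Suc N))"
         "inverse (real (Suc j)) \<le> inverse (real (Suc N))"
      using that by (simp_all add: le_imp_inverse_le)
    then show ?thesis
      using par[of "X i" "X j"] X[of i] X[of j] m_le[of "(1/2) *\<^sub>R (X i + X j)"] by linarith
  qed
  have "Cauchy X"
  proof (rule metric_CauchyI)
    fix e :: real assume "0 < e"
    then obtain N where N: "inverse (real (Suc N)) < e\<^sup>2 / 4"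
      using reals_Archimedean[of "e\<^sup>2 / 4"] by auto
    have "dist (X i) (X j) < e" if "N \<le> i" "N \<le> j" for i j
    proof -
      have "(norm (X i - X j))\<^sup>2 < e\<^sup>2"
        using close[OF that] N by linarith
      then show ?thesis
        using \<open>0 < e\<close> by (simp add: dist_norm power_less_imp_less_base)
    qed
    then show "\<exists>M. \<forall>i\<ge>M. \<forall>j\<ge>M. dist (X i) (X j) < e"
      by blast
  qed
  then obtain y where y: "X \<longlonglongrightarrow> y"
    using Cauchy_convergent convergent_def by blast
  have "(\<lambda>n. J (X n)) \<longlonglongrightarrow> J y"
    unfolding J_def by (intro tendsto_intros f.tendsto y)
  moreover have "(\<lambda>n. m + inverse (real (Suc n))) \<longlonglongrightarrow> m + 0"
    by (intro tendsto_intros LIMSEQ_inverse_real_of_nat)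
  ultimately have Jy: "J y \<le> m + 0"
    using X by (intro LIMSEQ_le[where Y = "\<lambda>n. m + inverse (real (Suc n))"]) (auto intro: less_imp_le)
  have "f x = Re (cinner x y)" for x
  proof -
    have "Re (cinner x y) - f x = 0"
    proof (rule eq_0_if_quadratic_nonneg)
      fix t :: real
      have "J y \<le> J (y + t *\<^sub>R x)"
        using Jy m_le[of "y + t *\<^sub>R x"] by simp
      then show "0 \<le> 2 * t * (Re (cinner x y) - f x) + t\<^sup>2 * (norm x)\<^sup>2"
        using Re_cinner_commute[of x y]
        by (simp add: J_def norm_add_square f.add f.scaleR cinner_scaleR_right power_mult_distrib
            algebra_simps)
    qed
    then show ?thesis by simp
  qed
  then show ?thesis by blast
qed

lemma bounded_opsD: "T \<in> bounded_ops \<Longrightarrow> blinfun_apply T (c *\<^sub>C x) = c *\<^sub>C blinfun_apply T x"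
  by (simp add: bounded_ops_def)

lemma adjoint_exists:
  fixes T :: "'h::complex_hilbert \<Rightarrow>\<^sub>L 'h"
  assumes T: "T \<in> bounded_ops"
  shows "\<exists>S\<in>bounded_ops. \<forall>x y. cinner (T x) y = cinner x (S y)"
proof -
  have "\<exists>y. \<forall>x. Re (cinner (T x) z) = Re (cinner x y)" for z
  proof (rule riesz_representation_Re, rule bounded_linear_intro)
    fix x
    have "\<bar>Re (cinner (T x) z)\<bar> \<le> norm (T x) * norm z"
      by (rule Re_cinner_bound)
    also have "\<dots> \<le> norm T * norm x * norm z"
      by (intro mult_right_mono norm_blinfun) simp
    finally show "norm (Re (cinner (T x) z)) \<le> norm x * (norm T * norm z)"
      by (simp add: mult_ac)
  qed (simp_all add: blinfun.add_right blinfun.scaleR_right cinner_linear)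
  then obtain S where S: "\<And>x z. Re (cinner (T x) z) = Re (cinner x (S z))"
    by metis
  have adj: "cinner (T x) z = cinner x (S z)" for x z
  proof (rule complex_eqI)
    show "Im (cinner (T x) z) = Im (cinner x (S z))"
      using S[of "\<i> *\<^sub>C x" z] by (simp add: bounded_opsD[OF T] cinner_scaleC_left)
  qed (rule S)
  have bound: "norm (S z) \<le> norm z * norm T" for z
  proof -
    have "(norm (S z))\<^sup>2 = Re (cinner (T (S z)) z)"
      by (simp add: adj Re_cinner_self)
    also have "\<dots> \<le> norm (T (S z)) * norm z"
      using Re_cinner_bound[of "T (S z)" z] by linarith
    also have "\<dots> \<le> norm T * norm (S z) * norm z"
      by (intro mult_right_mono norm_blinfun) simp
    finally have "norm (S z) * norm (S z) \<le> norm (S z) * (norm z * norm T)"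
      by (simp add: power2_eq_square mult_ac)
    then show ?thesis
      by (cases "S z = 0") simp_all
  qed
  have lin: "bounded_linear S"
  proof (rule bounded_linear_intro)
    show "norm (S z) \<le> norm z * norm T" for z
      by (rule bound)
    show "S (x + y) = S x + S y" for x y
      by (rule cinner_ext) (simp add: cinner_linear adj[symmetric])
    show "S (r *\<^sub>R x) = r *\<^sub>R S x" for r x
      by (rule cinner_ext) (simp add: cinner_linear adj[symmetric])
  qed
  have "S (c *\<^sub>C x) = c *\<^sub>C S x" for c x
    by (rule cinner_ext) (simp add: cinner_linear adj[symmetric])
  then have "Blinfun S \<in> bounded_ops"
    by (simp add: bounded_ops_def bounded_linear_Blinfun_apply[OF lin])
  then show ?thesis
    using adj by (intro bexI[of _ "Blinfun S"]) (simp_all add: bounded_linear_Blinfun_apply[OF lin])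
qed

text \<open>The Hilbert space adjoint; its value is unspecified outside \<open>bounded_ops\<close>.\<close>

definition adj_op :: "('h::complex_hilbert \<Rightarrow>\<^sub>L 'h) \<Rightarrow> ('h \<Rightarrow>\<^sub>L 'h)" where
  "adj_op T = (SOME S. S \<in> bounded_ops \<and> (\<forall>x y. cinner (T x) y = cinner x (S y)))"

lemma adj_op_spec:
  assumes "T \<in> bounded_ops"
  shows "adj_op T \<in> bounded_ops \<and> (\<forall>x y. cinner (T x) y = cinner x (adj_op T y))"
proof -
  have "\<exists>S. S \<in> bounded_ops \<and> (\<forall>x y. cinner (T x) y = cinner x (S y))"
    using adjoint_exists[OF assms] by blast
  then show ?thesis
    unfolding adj_op_def by (rule someI_ex)
qed

lemma adj_op_bounded_ops: "T \<in> bounded_ops \<Longrightarrow> adj_op T \<in> bounded_ops"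
  using adj_op_spec by blast

lemma cinner_adj_op_right: "T \<in> bounded_ops \<Longrightarrow> cinner x (adj_op T y) = cinner (T x) y"
  using adj_op_spec by metis

lemma cinner_adj_op_left: "T \<in> bounded_ops \<Longrightarrow> cinner (adj_op T x) y = cinner x (T y)"
  using cinner_adj_op_right[of T y x] cinner_commute[of "adj_op T x" y] cinner_commute[of x "T y"]
  by simp

lemma adj_op_eqI:
  fixes T S :: "'h::complex_hilbert \<Rightarrow>\<^sub>L 'h"
  assumes "T \<in> bounded_ops" "\<And>x y. cinner (T x) y = cinner x (S y)"
  shows "adj_op T = S"
  by (rule blinfun_eqI, rule cinner_ext) (simp add: cinner_adj_op_right assms)

lemma bounded_ops_add: "A \<in> bounded_ops \<Longrightarrow> B \<in> bounded_ops \<Longrightarrow> A + B \<in> bounded_ops"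
  by (simp add: bounded_ops_def blinfun.add_left scaleC_add_right)

lemma bounded_ops_scale: "A \<in> bounded_ops \<Longrightarrow> scale_op c A \<in> bounded_ops"
  by (simp add: bounded_ops_def scale_op.rep_eq scaleC_scaleC mult.commute)

lemma scale_op_minus1: "scale_op (-1) A = - A"
  by (rule blinfun_eqI) (simp add: scale_op.rep_eq scaleC_minus1 blinfun.minus_left)

lemma scale_op_of_real: "scale_op (of_real r) A = r *\<^sub>R A"
  by (rule blinfun_eqI) (simp add: scale_op.rep_eq scaleC_of_real blinfun.scaleR_left)

lemma bounded_ops_scaleR: "A \<in> bounded_ops \<Longrightarrow> r *\<^sub>R A \<in> bounded_ops"
  using bounded_ops_scale[of A "of_real r"] by (simp add: scale_op_of_real)

lemma bounded_ops_diff: "A \<in> bounded_ops \<Longrightarrow> B \<in> bounded_ops \<Longrightarrow> A - B \<in> bounded_ops"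
  using bounded_ops_add[of A "- B"] bounded_ops_scale[of B "-1"] by (simp add: scale_op_minus1)

lemma bounded_ops_compose: "A \<in> bounded_ops \<Longrightarrow> B \<in> bounded_ops \<Longrightarrow> A o\<^sub>L B \<in> bounded_ops"
  by (simp add: bounded_ops_def)

lemma bounded_ops_id: "id_blinfun \<in> bounded_ops"
  by (simp add: bounded_ops_def)

lemma bounded_ops_0: "0 \<in> bounded_ops"
  by (simp add: bounded_ops_def blinfun.zero_left)

lemma bounded_ops_sum: "(\<And>i. i \<in> I \<Longrightarrow> A i \<in> bounded_ops) \<Longrightarrow> sum A I \<in> bounded_ops"
  by (induction I rule: infinite_finite_induct) (auto intro: bounded_ops_0 bounded_ops_add)

lemmas bounded_ops_intros = bounded_ops_add bounded_ops_scale bounded_ops_diff bounded_ops_compose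
  bounded_ops_id bounded_ops_0 adj_op_bounded_ops bounded_ops_scaleR

text \<open>Over the complex numbers an operator is determined by its quadratic form.\<close>

lemma op_eq_0_if_quadratic_form_0:
  fixes A :: "'h::complex_hilbert \<Rightarrow>\<^sub>L 'h"
  assumes A: "A \<in> bounded_ops" and q: "\<And>x. cinner (A x) x = 0"
  shows "A = 0"
proof (rule blinfun_eqI)
  fix x
  have "cinner (A x) y = 0" for y
  proof -
    have 1: "cinner (A x) y + cinner (A y) x = 0"
      using q[of "x + y"] by (simp add: blinfun.add_right cinner_linear q add.commute)
    have "\<i> * (cinner (A y) x - cinner (A x) y) = 0"
      using q[of "x + \<i> *\<^sub>C y"]
      by (simp add: blinfun.add_right bounded_opsD[OF A] cinner_linear q algebra_simps)
    then have "cinner (A y) x = cinner (A x) y"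
      by simp
    then show ?thesis
      using 1 by simp
  qed
  then have "cinner (A x) (A x) = 0" .
  then show "A x = blinfun_apply 0 x"
    by (simp add: cinner_self blinfun.zero_left)
qed


section \<open>Unital completely positive maps\<close>

lemma gamma_mapD:
  assumes "gamma_map G \<pi> bounded_ops T \<Phi>"
  shows "x \<in> bounded_ops \<Longrightarrow> \<Phi> x \<in> T"
    and "x \<in> bounded_ops \<Longrightarrow> y \<in> bounded_ops \<Longrightarrow> \<Phi> (x + y) = \<Phi> x + \<Phi> y"
    and "x \<in> bounded_ops \<Longrightarrow> \<Phi> (scale_op c x) = scale_op c (\<Phi> x)"
    and "\<Phi> id_blinfun = id_blinfun"
    and "completely_positive_on bounded_ops \<Phi>"
    and "g \<in> carrier G \<Longrightarrow> x \<in> bounded_ops \<Longrightarrow> \<Phi> (conj_action G \<pi> g x) = conj_action G \<pi> g (\<Phi> x)"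
  using assms unfolding gamma_map_def by blast+

lemma gamma_map_pos_matrix:
  assumes "gamma_map G \<pi> bounded_ops T \<Phi>"
    and "\<And>i j. i < n \<Longrightarrow> j < n \<Longrightarrow> a i j \<in> bounded_ops" and "pos_matrix n a"
  shows "pos_matrix n (\<lambda>i j. \<Phi> (a i j))"
  using gamma_mapD(5)[OF assms(1)] assms(2,3) unfolding completely_positive_on_def by simp

lemma gamma_map_diff:
  assumes \<Phi>: "gamma_map G \<pi> bounded_ops T \<Phi>" and "x \<in> bounded_ops" "y \<in> bounded_ops"
  shows "\<Phi> (x - y) = \<Phi> x - \<Phi> y"
  using gamma_mapD(2)[OF \<Phi>, of x "- y"] gamma_mapD(3)[OF \<Phi>, of y "-1"]
    bounded_ops_scale[of y "-1"] assms(2-) by (simp add: scale_op_minus1)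

lemma gamma_map_mono_codomain:
  "gamma_map G \<pi> S T \<Phi> \<Longrightarrow> T \<subseteq> U \<Longrightarrow> gamma_map G \<pi> S U \<Phi>"
  unfolding gamma_map_def by blast

lemma gamma_map_pos_op:
  assumes \<Phi>: "gamma_map G \<pi> bounded_ops T \<Phi>" and "a \<in> bounded_ops" "pos_op a"
  shows "pos_op (\<Phi> a)"
proof -
  have "pos_matrix 1 (\<lambda>i j. a)"
    using assms by (simp add: pos_matrix_def pos_op_def)
  then have "pos_matrix 1 (\<lambda>i j. \<Phi> a)"
    using gamma_map_pos_matrix[OF \<Phi>, of 1 "\<lambda>i j. a"] assms by simp
  then have "cinner (\<Phi> a x) x \<in> \<real>\<^sub>\<ge>\<^sub>0" for x
    unfolding pos_matrix_def by (drule_tac x = "\<lambda>_. x" in spec) simp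
  then show ?thesis
    by (simp add: pos_op_def)
qed

text \<open>The image under \<open>\<Phi>\<close> of the positive matrix with rows \<open>(1, x)\<close> and \<open>(x\<^sup>*, x\<^sup>* x)\<close>.\<close>

lemma gamma_map_two_positive:
  fixes \<Phi> :: "('h::complex_hilbert \<Rightarrow>\<^sub>L 'h) \<Rightarrow> ('h \<Rightarrow>\<^sub>L 'h)"
  assumes \<Phi>: "gamma_map G \<pi> bounded_ops T \<Phi>" and x: "x \<in> bounded_ops"
  shows "cinner u u + cinner (\<Phi> x v) u + cinner (\<Phi> (adj_op x) u) v
    + cinner (\<Phi> (adj_op x o\<^sub>L x) v) v \<in> \<real>\<^sub>\<ge>\<^sub>0"
proof -
  define a where "a = (\<lambda>(i::nat) (j::nat). if i = 0 then if j = 0 then id_blinfun else x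
    else if j = 0 then adj_op x else adj_op x o\<^sub>L x)"
  define \<xi> where "\<xi> = (\<lambda>i::nat. if i = 0 then u else v)"
  have "pos_matrix 2 a"
    unfolding pos_matrix_def
  proof
    fix \<xi> :: "nat \<Rightarrow> 'h"
    have "(\<Sum>i<2. \<Sum>j<2. cinner (a i j (\<xi> j)) (\<xi> i)) = cinner (\<xi> 0 + x (\<xi> 1)) (\<xi> 0 + x (\<xi> 1))"
      by (simp add: numeral_2_eq_2 a_def cinner_linear cinner_adj_op_left[OF x])
    then show "(\<Sum>i<2. \<Sum>j<2. cinner (a i j (\<xi> j)) (\<xi> i)) \<in> \<real>\<^sub>\<ge>\<^sub>0"
      by (simp add: cinner_self)
  qed
  moreover have "a i j \<in> bounded_ops" for i j
    by (simp add: a_def x bounded_ops_intros)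
  ultimately have "pos_matrix 2 (\<lambda>i j. \<Phi> (a i j))"
    by (intro gamma_map_pos_matrix[OF \<Phi>])
  then have "(\<Sum>i<2. \<Sum>j<2. cinner (\<Phi> (a i j) (\<xi> j)) (\<xi> i)) \<in> \<real>\<^sub>\<ge>\<^sub>0"
    unfolding pos_matrix_def by blast
  moreover have "(\<Sum>i<2. \<Sum>j<2. cinner (\<Phi> (a i j) (\<xi> j)) (\<xi> i))
    = cinner u u + cinner (\<Phi> x v) u + cinner (\<Phi> (adj_op x) u) v
      + cinner (\<Phi> (adj_op x o\<^sub>L x) v) v"
    by (simp add: numeral_2_eq_2 a_def \<xi>_def gamma_mapD(4)[OF \<Phi>])
  ultimately show ?thesis by simp
qed

text \<open>The form in \<open>gamma_map_two_positive\<close> is real; comparing its values at \<open>(u, v)\<close> and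
  \<open>(\<i> u, v)\<close> shows that \<open>\<Phi>\<close> preserves adjoints.\<close>

lemma gamma_map_adj:
  fixes \<Phi> :: "('h::complex_hilbert \<Rightarrow>\<^sub>L 'h) \<Rightarrow> ('h \<Rightarrow>\<^sub>L 'h)"
  assumes \<Phi>: "gamma_map G \<pi> bounded_ops bounded_ops \<Phi>" and x: "x \<in> bounded_ops"
  shows "\<Phi> (adj_op x) = adj_op (\<Phi> x)"
proof (rule adj_op_eqI[symmetric])
  show bx: "\<Phi> x \<in> bounded_ops"
    using gamma_mapD(1)[OF \<Phi>] x by blast
  fix v u
  have bax: "\<Phi> (adj_op x) \<in> bounded_ops"
    using gamma_mapD(1)[OF \<Phi>] x adj_op_bounded_ops by blast
  let ?p = "cinner (\<Phi> x v) u" and ?q = "cinner (\<Phi> (adj_op x) u) v"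
  have d: "Im (cinner (\<Phi> (adj_op x o\<^sub>L x) v) v) = 0"
    using gamma_map_two_positive[OF \<Phi> x, of 0 v]
    by (simp add: complex_nonneg_Reals_iff blinfun.zero_right)
  have "Im ?p + Im ?q = 0"
    using gamma_map_two_positive[OF \<Phi> x, of u v] d
    by (simp add: complex_nonneg_Reals_iff cinner_self)
  moreover have "- Re ?p + Re ?q = 0"
    using gamma_map_two_positive[OF \<Phi> x, of "\<i> *\<^sub>C u" v] d
    by (simp add: complex_nonneg_Reals_iff cinner_self bounded_opsD[OF bax]
        cinner_scaleC_left cinner_scaleC_right)
  ultimately have "?p = cnj ?q"
    by (intro complex_eqI) simp_all
  then show "cinner (\<Phi> x v) u = cinner v (\<Phi> (adj_op x) u)"
    by (metis cinner_commute)
qed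

text \<open>The Kadison--Schwarz inequality \<open>\<Phi>(x)\<^sup>* \<Phi>(x) \<le> \<Phi>(x\<^sup>* x)\<close>.\<close>

lemma gamma_map_schwarz:
  fixes \<Phi> :: "('h::complex_hilbert \<Rightarrow>\<^sub>L 'h) \<Rightarrow> ('h \<Rightarrow>\<^sub>L 'h)"
  assumes \<Phi>: "gamma_map G \<pi> bounded_ops bounded_ops \<Phi>" and x: "x \<in> bounded_ops"
  shows "pos_op (\<Phi> (adj_op x o\<^sub>L x) - (adj_op (\<Phi> x) o\<^sub>L \<Phi> x))"
  unfolding pos_op_def
proof
  fix v
  have bx: "\<Phi> x \<in> bounded_ops"
    using gamma_mapD(1)[OF \<Phi>] x by blast
  show "cinner ((\<Phi> (adj_op x o\<^sub>L x) - (adj_op (\<Phi> x) o\<^sub>L \<Phi> x)) v) v \<in> \<real>\<^sub>\<ge>\<^sub>0"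
    using gamma_map_two_positive[OF \<Phi> x, of "- \<Phi> x v" v]
    by (simp add: gamma_map_adj[OF \<Phi> x] cinner_adj_op_left[OF bx] blinfun.diff_left
        blinfun.minus_right cinner_linear)
qed

lemma gamma_map_contractive:
  fixes \<Phi> :: "('h::complex_hilbert \<Rightarrow>\<^sub>L 'h) \<Rightarrow> ('h \<Rightarrow>\<^sub>L 'h)"
  assumes \<Phi>: "gamma_map G \<pi> bounded_ops bounded_ops \<Phi>" and x: "x \<in> bounded_ops"
  shows "norm (\<Phi> x) \<le> norm x"
proof (rule norm_blinfun_bound)
  fix v
  have bx: "\<Phi> x \<in> bounded_ops"
    using gamma_mapD(1)[OF \<Phi>] x by blast
  let ?y = "adj_op x o\<^sub>L x"
  have y: "?y \<in> bounded_ops"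
    by (simp add: x bounded_ops_intros)
  let ?N = "(norm x)\<^sup>2"
  have "pos_op (scale_op (of_real ?N) id_blinfun - ?y)"
    unfolding pos_op_def
  proof
    fix w
    have "(norm (x w))\<^sup>2 \<le> (norm x * norm w)\<^sup>2"
      by (intro power_mono norm_blinfun) simp
    then show "cinner ((scale_op (of_real ?N) id_blinfun - ?y) w) w \<in> \<real>\<^sub>\<ge>\<^sub>0"
      by (simp add: complex_nonneg_Reals_iff blinfun.diff_left scale_op.rep_eq cinner_linear
          cinner_adj_op_left[OF x] cinner_self power_mult_distrib del: of_real_power)
  qed
  then have "pos_op (\<Phi> (scale_op (of_real ?N) id_blinfun - ?y))"
    by (rule gamma_map_pos_op[OF \<Phi>, rotated]) (simp add: y bounded_ops_intros)
  then have "pos_op (scale_op (of_real ?N) id_blinfun - \<Phi> ?y)"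
    using gamma_map_diff[OF \<Phi> bounded_ops_scale[OF bounded_ops_id] y]
      gamma_mapD(3)[OF \<Phi> bounded_ops_id] by (simp add: gamma_mapD(4)[OF \<Phi>])
  then have "Re (cinner (\<Phi> ?y v) v) \<le> ?N * (norm v)\<^sup>2"
    by (auto dest!: spec[of _ v] simp: pos_op_def complex_nonneg_Reals_iff blinfun.diff_left
        scale_op.rep_eq cinner_linear cinner_self simp del: of_real_power)
  moreover have "(norm (\<Phi> x v))\<^sup>2 \<le> Re (cinner (\<Phi> ?y v) v)"
    using gamma_map_schwarz[OF \<Phi> x]
    by (auto dest!: spec[of _ v] simp: pos_op_def complex_nonneg_Reals_iff blinfun.diff_left
        cinner_linear cinner_adj_op_left[OF bx] cinner_self simp del: of_real_power)
  ultimately have "(norm (\<Phi> x v))\<^sup>2 \<le> (norm x * norm v)\<^sup>2"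
    by (simp add: power_mult_distrib)
  then show "norm (\<Phi> x v) \<le> norm x * norm v"
    by (rule power2_le_imp_le) simp
qed simp


section \<open>Rigidity of the boundary\<close>

lemma hom_unitary_bounded_ops: "\<pi> \<in> hom G unitary_group \<Longrightarrow> g \<in> carrier G \<Longrightarrow> \<pi> g \<in> bounded_ops"
  unfolding hom_def unitary_group_def by auto

lemma conj_action_bounded_ops:
  assumes "group G" "\<pi> \<in> hom G unitary_group" "g \<in> carrier G" "x \<in> bounded_ops"
  shows "conj_action G \<pi> g x \<in> bounded_ops"
  using hom_unitary_bounded_ops[OF assms(2)] group.inv_closed[OF assms(1)] assms(3,4)
  unfolding conj_action_def by (simp add: bounded_ops_compose)

lemma scale_op_compose_left: "scale_op c (A o\<^sub>L B) = scale_op c A o\<^sub>L B"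
  by (rule blinfun_eqI) (simp add: scale_op.rep_eq)

lemma scale_op_compose_right: "A \<in> bounded_ops \<Longrightarrow> A o\<^sub>L scale_op c B = scale_op c (A o\<^sub>L B)"
  by (rule blinfun_eqI) (simp add: scale_op.rep_eq bounded_opsD)

lemma blinfun_compose_sum_left: "(\<Sum>i\<in>I. A i) o\<^sub>L B = (\<Sum>i\<in>I. A i o\<^sub>L B)"
  by (rule blinfun_eqI) (simp add: blinfun.sum_left)

lemma blinfun_compose_sum_right: "B o\<^sub>L (\<Sum>i\<in>I. A i) = (\<Sum>i\<in>I. B o\<^sub>L A i)"
  by (rule blinfun_eqI) (simp add: blinfun.sum_left blinfun.sum_right)

lemma gamma_map_compose:
  fixes \<Phi> \<Psi> :: "('h::complex_hilbert \<Rightarrow>\<^sub>L 'h) \<Rightarrow> ('h \<Rightarrow>\<^sub>L 'h)"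
  assumes \<Phi>: "gamma_map G \<pi> bounded_ops bounded_ops \<Phi>"
    and \<Psi>: "gamma_map G \<pi> bounded_ops bounded_ops \<Psi>"
  shows "gamma_map G \<pi> bounded_ops bounded_ops (\<lambda>x. \<Psi> (\<Phi> x))"
  unfolding gamma_map_def
proof (intro conjI ballI allI)
  show "completely_positive_on bounded_ops (\<lambda>x. \<Psi> (\<Phi> x))"
    unfolding completely_positive_on_def
  proof (intro allI impI)
    fix n and a :: "nat \<Rightarrow> nat \<Rightarrow> 'h \<Rightarrow>\<^sub>L 'h"
    assume a: "\<forall>i<n. \<forall>j<n. a i j \<in> bounded_ops" "pos_matrix n a"
    have "pos_matrix n (\<lambda>i j. \<Phi> (a i j))"
      by (rule gamma_map_pos_matrix[OF \<Phi>]) (use a in auto)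
    then show "pos_matrix n (\<lambda>i j. \<Psi> (\<Phi> (a i j)))"
      by (rule gamma_map_pos_matrix[OF \<Psi>, rotated]) (use a gamma_mapD(1)[OF \<Phi>] in auto)
  qed
qed (use gamma_mapD[OF \<Phi>] gamma_mapD[OF \<Psi>] in auto)

lemma gamma_map_funpow:
  assumes "gamma_map G \<pi> bounded_ops bounded_ops \<Phi>" "gamma_map G \<pi> bounded_ops bounded_ops \<phi>"
  shows "gamma_map G \<pi> bounded_ops bounded_ops (\<lambda>x. (\<Phi> ^^ k) (\<phi> x))"
proof (induction k)
  case (Suc k)
  show ?case
    using gamma_map_compose[OF Suc assms(1)] by simp
qed (simp add: assms(2))

lemma scale_op_add: "scale_op c (x + y) = scale_op c x + scale_op c y"
  by (rule module.scale_right_distrib[OF module_scale_op])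

lemma scale_op_scale_op: "scale_op c (scale_op d x) = scale_op (c * d) x"
  by (rule module.scale_scale[OF module_scale_op])

lemma scale_op_sum: "scale_op c (sum f I) = (\<Sum>i\<in>I. scale_op c (f i))"
  by (rule module.scale_sum_right[OF module_scale_op])

lemma gamma_map_average:
  fixes F :: "nat \<Rightarrow> ('h::complex_hilbert \<Rightarrow>\<^sub>L 'h) \<Rightarrow> ('h \<Rightarrow>\<^sub>L 'h)"
  assumes G: "group G" and \<pi>: "\<pi> \<in> hom G unitary_group"
    and F: "\<And>k. gamma_map G \<pi> bounded_ops bounded_ops (F k)" and n: "0 < n"
  shows "gamma_map G \<pi> bounded_ops bounded_ops (\<lambda>x. scale_op (1 / of_nat n) (\<Sum>k<n. F k x))"
    (is "gamma_map G \<pi> _ _ ?\<eta>")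
  unfolding gamma_map_def
proof (intro conjI ballI allI)
  have inF: "F k x \<in> bounded_ops" if "x \<in> bounded_ops" for k x
    using gamma_mapD(1)[OF F] that by blast
  show "?\<eta> ` bounded_ops \<subseteq> bounded_ops"
    by (auto intro!: bounded_ops_scale bounded_ops_sum inF)
  show "?\<eta> (x + y) = ?\<eta> x + ?\<eta> y" if "x \<in> bounded_ops" "y \<in> bounded_ops" for x y
    using that by (simp add: gamma_mapD(2)[OF F] sum.distrib scale_op_add)
  show "?\<eta> (scale_op c x) = scale_op c (?\<eta> x)" if "x \<in> bounded_ops" for c x
    using that
    by (simp add: gamma_mapD(3)[OF F] scale_op_sum[symmetric] scale_op_scale_op mult.commute)
  show "?\<eta> id_blinfun = id_blinfun"
    using n by (intro blinfun_eqI)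
      (simp add: gamma_mapD(4)[OF F] scale_op.rep_eq blinfun.sum_left blinfun.scaleR_left
         sum_constant_scaleR scaleC_of_real[symmetric] scaleC_scaleC)
  show "?\<eta> (conj_action G \<pi> g x) = conj_action G \<pi> g (?\<eta> x)"
    if "g \<in> carrier G" "x \<in> bounded_ops" for g x
    using that gamma_mapD(6)[OF F that]
    by (simp add: conj_action_def scale_op_compose_left[symmetric]
        scale_op_compose_right[OF hom_unitary_bounded_ops[OF \<pi>]]
        blinfun_compose_sum_left blinfun_compose_sum_right)
  show "completely_positive_on bounded_ops ?\<eta>"
    unfolding completely_positive_on_def
  proof (intro allI impI)
    fix m and a :: "nat \<Rightarrow> nat \<Rightarrow> 'h \<Rightarrow>\<^sub>L 'h"
    assume a: "\<forall>i<m. \<forall>j<m. a i j \<in> bounded_ops" "pos_matrix m a"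
    show "pos_matrix m (\<lambda>i j. ?\<eta> (a i j))"
      unfolding pos_matrix_def
    proof
      fix \<xi> :: "nat \<Rightarrow> 'h"
      let ?q = "\<lambda>k. \<Sum>i<m. \<Sum>j<m. cinner (F k (a i j) (\<xi> j)) (\<xi> i)"
      have q: "?q k \<in> \<real>\<^sub>\<ge>\<^sub>0" for k
        using gamma_map_pos_matrix[OF F, of m a k] a unfolding pos_matrix_def by simp
      have sum_pos: "sum f {..<n} \<in> \<real>\<^sub>\<ge>\<^sub>0" if "\<And>k. f k \<in> \<real>\<^sub>\<ge>\<^sub>0" for f :: "nat \<Rightarrow> complex"
        using that by (simp add: complex_nonneg_Reals_iff sum_nonneg)
      have "1 / of_nat n \<in> (\<real>\<^sub>\<ge>\<^sub>0 :: complex set)"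
        by (metis divide_nonneg_nonneg nonneg_Reals_of_real_iff of_nat_0_le_iff of_real_1 of_real_divide of_real_of_nat_eq zero_le_one)
      then have "1 / of_nat n * (\<Sum>k<n. ?q k) \<in> \<real>\<^sub>\<ge>\<^sub>0"
        by (rule nonneg_Reals_mult_I) (rule sum_pos, rule q)
      moreover have "cinner (?\<eta> A v) w = 1 / of_nat n * (\<Sum>k<n. cinner (F k A v) w)" for A v w
      proof -
        have "cinner (sum f {..<n}) w = (\<Sum>k<n. cinner (f k) w)" for f
          by (induction n) (simp_all add: cinner_add_left)
        then show ?thesis
          by (simp add: scale_op.rep_eq cinner_scaleC_left blinfun.sum_left)
      qed
      moreover have "(\<Sum>k<n. ?q k) = (\<Sum>i<m. \<Sum>j<m. \<Sum>k<n. cinner (F k (a i j) (\<xi> j)) (\<xi> i))"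
        by (rule trans[OF sum.swap], rule sum.cong[OF refl], rule sum.swap)
      ultimately show "(\<Sum>i<m. \<Sum>j<m. cinner (?\<eta> (a i j) (\<xi> j)) (\<xi> i)) \<in> \<real>\<^sub>\<ge>\<^sub>0"
        by (simp add: sum_distrib_left)
    qed
  qed
qed

text \<open>Averaging the maps \<open>\<Phi>\<^sup>k \<circ> \<phi>\<close> over \<open>k < n\<close> gives \<open>\<Gamma>\<close>-maps below \<open>\<phi>\<close> whose values at \<open>y\<close>
  have norm at most \<open>2 \<parallel>z\<parallel> / n\<close>; minimality of \<open>\<phi>\<close> transfers this bound to \<open>\<phi> y\<close>.\<close>

lemma minimal_gamma_map_coboundary:
  fixes \<phi> \<Phi> :: "('h::complex_hilbert \<Rightarrow>\<^sub>L 'h) \<Rightarrow> ('h \<Rightarrow>\<^sub>L 'h)"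
  assumes G: "group G" and \<pi>: "\<pi> \<in> hom G unitary_group"
    and min: "minimal_gamma_map G \<pi> \<phi>"
    and \<Phi>: "gamma_map G \<pi> bounded_ops bounded_ops \<Phi>"
    and y: "y \<in> bounded_ops" and z: "z \<in> bounded_ops" and eq: "\<phi> y = \<Phi> z - z"
  shows "\<phi> y = 0"
proof -
  have \<phi>: "gamma_map G \<pi> bounded_ops bounded_ops \<phi>"
    using min by (simp add: minimal_gamma_map_def)
  define F where "F k x = (\<Phi> ^^ k) (\<phi> x)" for k x
  have F: "gamma_map G \<pi> bounded_ops bounded_ops (F k)" for k
    unfolding F_def by (rule gamma_map_funpow[OF \<Phi> \<phi>])
  have pow: "(\<Phi> ^^ k) x \<in> bounded_ops \<and> norm ((\<Phi> ^^ k) x) \<le> norm x" if "x \<in> bounded_ops" for k x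
  proof (induction k)
    case (Suc k)
    then show ?case
      using gamma_mapD(1)[OF \<Phi>, of "(\<Phi> ^^ k) x"] gamma_map_contractive[OF \<Phi>, of "(\<Phi> ^^ k) x"]
      by simp
  qed (simp add: that)
  have bound: "norm (\<phi> y) \<le> 2 * norm z / real n" if n: "0 < n" for n
  proof -
    let ?\<eta> = "\<lambda>x. scale_op (1 / of_nat n) (\<Sum>k<n. F k x)"
    have norm_\<eta>: "norm (?\<eta> x) = norm (\<Sum>k<n. F k x) / real n" for x
      using scale_op_of_real[of "1 / real n" "\<Sum>k<n. F k x"] by (simp add: divide_simps)
    have "map_le ?\<eta> \<phi>"
      unfolding map_le_def
    proof
      fix x :: "'h \<Rightarrow>\<^sub>L 'h" assume "x \<in> bounded_ops"
      then have "norm (F k x) \<le> norm (\<phi> x)" for k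
        using pow[of "\<phi> x" k] gamma_mapD(1)[OF \<phi>, of x] by (simp add: F_def)
      then have "norm (\<Sum>k<n. F k x) \<le> real n * norm (\<phi> x)"
        using sum_norm_bound[of "{..<n}" "\<lambda>k. F k x" "norm (\<phi> x)"] by simp
      then show "norm (?\<eta> x) \<le> norm (\<phi> x)"
        unfolding norm_\<eta> using n by (simp add: field_simps)
    qed
    then have "map_le \<phi> ?\<eta>"
      using min[unfolded minimal_gamma_map_def, THEN conjunct2, rule_format,
          OF gamma_map_average[OF G \<pi> F n]] by simp
    then have "norm (\<phi> y) \<le> norm (\<Sum>k<n. F k y) / real n"
      using y unfolding map_le_def norm_\<eta> by simp
    also have "(\<Sum>k<n. F k y) = (\<Phi> ^^ n) z - z"
    proof -
      have step: "F k y = (\<Phi> ^^ Suc k) z - (\<Phi> ^^ k) z" for k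
      proof (induction k)
        case (Suc k)
        have "F (Suc k) y = \<Phi> (F k y)"
          by (simp add: F_def)
        then show ?case
          using Suc pow[OF z, of k] pow[OF z, of "Suc k"]
            gamma_map_diff[OF \<Phi>, of "(\<Phi> ^^ Suc k) z" "(\<Phi> ^^ k) z"] by simp
      qed (simp add: F_def eq)
      show ?thesis
        unfolding step by (subst sum_lessThan_telescope) simp
    qed
    also have "norm ((\<Phi> ^^ n) z - z) / real n \<le> 2 * norm z / real n"
      using norm_triangle_ineq4[of "(\<Phi> ^^ n) z" z] pow[OF z, of n] n
      by (intro divide_right_mono) auto
    finally show ?thesis .
  qed
  have "(\<lambda>n. 2 * norm z / real n) \<longlonglongrightarrow> 0"
    by (rule lim_const_over_n)
  then have "norm (\<phi> y) \<le> 0"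
    by (rule LIMSEQ_le_const) (use bound in \<open>auto intro!: exI[of _ 1]\<close>)
  then show ?thesis by simp
qed

text \<open>Here \<open>b = \<phi>(x)\<close>, and \<open>\<phi>(b) - b = \<phi>(b - x)\<close> is a coboundary for \<open>\<Phi> = \<phi>\<close>.\<close>

lemma minimal_gamma_map_idempotent:
  fixes \<phi> :: "('h::complex_hilbert \<Rightarrow>\<^sub>L 'h) \<Rightarrow> ('h \<Rightarrow>\<^sub>L 'h)"
  assumes "group G" "\<pi> \<in> hom G unitary_group" "minimal_gamma_map G \<pi> \<phi>" "b \<in> fh_boundary \<phi>"
  shows "\<phi> b = b"
proof -
  have \<phi>: "gamma_map G \<pi> bounded_ops bounded_ops \<phi>"
    using assms(3) by (simp add: minimal_gamma_map_def)
  obtain x where x: "x \<in> bounded_ops" "b = \<phi> x"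
    using assms(4) by (auto simp: fh_boundary_def)
  have b: "b \<in> bounded_ops"
    using gamma_mapD(1)[OF \<phi>] x by blast
  have "\<phi> (b - x) = \<phi> b - b"
    using gamma_map_diff[OF \<phi> b x(1)] x(2) by simp
  then show ?thesis
    using minimal_gamma_map_coboundary[OF assms(1-3) \<phi> bounded_ops_diff[OF b x(1)] b] by simp
qed

lemma gamma_map_to_boundary_fixes_boundary:
  fixes \<phi> \<Phi> :: "('h::complex_hilbert \<Rightarrow>\<^sub>L 'h) \<Rightarrow> ('h \<Rightarrow>\<^sub>L 'h)"
  assumes "group G" "\<pi> \<in> hom G unitary_group" "minimal_gamma_map G \<pi> \<phi>"
    and \<Phi>: "gamma_map G \<pi> bounded_ops (fh_boundary \<phi>) \<Phi>" and b: "b \<in> fh_boundary \<phi>"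
  shows "\<Phi> b = b"
proof -
  have \<phi>: "gamma_map G \<pi> bounded_ops bounded_ops \<phi>"
    using assms(3) by (simp add: minimal_gamma_map_def)
  have sub: "fh_boundary \<phi> \<subseteq> bounded_ops"
    using gamma_mapD(1)[OF \<phi>] by (auto simp: fh_boundary_def)
  have \<Phi>': "gamma_map G \<pi> bounded_ops bounded_ops \<Phi>"
    by (rule gamma_map_mono_codomain[OF \<Phi> sub])
  have \<Phi>b: "\<Phi> b \<in> fh_boundary \<phi>"
    using gamma_mapD(1)[OF \<Phi>] b sub by blast
  have fixed: "\<phi> c = c" if "c \<in> fh_boundary \<phi>" for c
    by (rule minimal_gamma_map_idempotent[OF assms(1-3) that])
  have eq: "\<phi> (\<Phi> b - b) = \<Phi> b - b"
    using gamma_map_diff[OF \<phi>, of "\<Phi> b" b] fixed[OF b] fixed[OF \<Phi>b] b \<Phi>b sub by auto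
  then have "\<phi> (\<Phi> b - b) = 0"
    using b \<Phi>b sub by (intro minimal_gamma_map_coboundary[OF assms(1-3) \<Phi>' _ _ eq]) (auto intro: bounded_ops_diff)
  then show ?thesis
    using eq by simp
qed


section \<open>Module property over the boundary\<close>

lemma adj_op_adj_op: "x \<in> bounded_ops \<Longrightarrow> adj_op (adj_op x) = x"
  by (rule adj_op_eqI) (auto simp: adj_op_bounded_ops cinner_adj_op_left)

lemma adj_op_compose:
  "x \<in> bounded_ops \<Longrightarrow> y \<in> bounded_ops \<Longrightarrow> adj_op (x o\<^sub>L y) = adj_op y o\<^sub>L adj_op x"
  by (rule adj_op_eqI) (auto simp: bounded_ops_compose cinner_adj_op_right)

lemma adj_op_0 [simp]: "adj_op 0 = 0"
  by (rule adj_op_eqI) (auto simp: bounded_ops_0 blinfun.zero_left)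

lemma adj_op_add_scale:
  "x \<in> bounded_ops \<Longrightarrow> w \<in> bounded_ops \<Longrightarrow>
    adj_op (x + scale_op z w) = adj_op x + scale_op (cnj z) (adj_op w)"
  by (rule adj_op_eqI)
    (auto simp: bounded_ops_intros blinfun.add_left scale_op.rep_eq cinner_linear cinner_adj_op_right)

text \<open>For \<open>x = b\<^sup>* + z w\<close> the Schwarz inequality reads \<open>\<Phi>(x\<^sup>* x) \<ge> b b\<^sup>*\<close>.  Applying the idempotent
  map \<open>\<Phi>\<close> once more gives \<open>z \<Phi>(b w) + (z \<Phi>(b w))\<^sup>* + \<bar>z\<bar>\<^sup>2 \<Phi>(w\<^sup>* w) \<ge> 0\<close> for every complex \<open>z\<close>,
  whose first-order part in \<open>z\<close> must vanish.\<close>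

lemma idempotent_gamma_map_right_kernel:
  fixes \<Phi> :: "('h::complex_hilbert \<Rightarrow>\<^sub>L 'h) \<Rightarrow> ('h \<Rightarrow>\<^sub>L 'h)"
  assumes \<Phi>: "gamma_map G \<pi> bounded_ops bounded_ops \<Phi>"
    and idem: "\<And>x. x \<in> bounded_ops \<Longrightarrow> \<Phi> (\<Phi> x) = \<Phi> x"
    and b: "b \<in> bounded_ops" "\<Phi> b = b" and w: "w \<in> bounded_ops" "\<Phi> w = 0"
  shows "\<Phi> (b o\<^sub>L w) = 0"
proof (rule op_eq_0_if_quadratic_form_0)
  have bw: "b o\<^sub>L w \<in> bounded_ops"
    by (simp add: b w bounded_ops_intros)
  show \<Phi>bw: "\<Phi> (b o\<^sub>L w) \<in> bounded_ops"
    using gamma_mapD(1)[OF \<Phi>] bw by blast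
  fix \<xi>
  let ?p = "b o\<^sub>L adj_op b" and ?q = "adj_op w o\<^sub>L w"
  define c where "c = cinner (\<Phi> (b o\<^sub>L w) \<xi>) \<xi>"
  define d where "d = cinner (\<Phi> ?q \<xi>) \<xi>"
  have pq: "?p \<in> bounded_ops" "?q \<in> bounded_ops"
    by (simp_all add: b w bounded_ops_intros)
  have pos: "Re (z * c + cnj z * cnj c + z * cnj z * d) \<ge> 0" for z
  proof -
    define x where "x = adj_op b + scale_op z w"
    have x: "x \<in> bounded_ops"
      by (simp add: x_def b w bounded_ops_intros)
    have \<Phi>x: "\<Phi> x = adj_op b"
      using gamma_mapD(2)[OF \<Phi>, of "adj_op b" "scale_op z w"] b w
      by (simp add: x_def gamma_map_adj[OF \<Phi>] gamma_mapD(3)[OF \<Phi>] bounded_ops_intros)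
         (rule blinfun_eqI, simp add: scale_op.rep_eq blinfun.zero_left)
    have xx: "adj_op x o\<^sub>L x = ?p + scale_op z (b o\<^sub>L w)
        + scale_op (cnj z) (adj_op (b o\<^sub>L w)) + scale_op (z * cnj z) ?q"
      using b w
      by (intro blinfun_eqI) (simp add: x_def adj_op_add_scale adj_op_adj_op adj_op_compose
          bounded_ops_intros blinfun.add_left blinfun.add_right scale_op.rep_eq bounded_opsD
          scaleC_add_right scaleC_scaleC mult_ac)
    have xx_in: "adj_op x o\<^sub>L x \<in> bounded_ops"
      by (simp add: x bounded_ops_intros)
    have \<Phi>xx: "\<Phi> (adj_op x o\<^sub>L x) = \<Phi> ?p + scale_op z (\<Phi> (b o\<^sub>L w))
        + scale_op (cnj z) (adj_op (\<Phi> (b o\<^sub>L w))) + scale_op (z * cnj z) (\<Phi> ?q)"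
      unfolding xx
      by (simp add: gamma_mapD(2,3)[OF \<Phi>] gamma_map_adj[OF \<Phi>] pq bw bounded_ops_intros)
    have \<Phi>xx_in: "\<Phi> (adj_op x o\<^sub>L x) \<in> bounded_ops"
      using gamma_mapD(1)[OF \<Phi>] xx_in by blast
    have "pos_op (\<Phi> (adj_op x o\<^sub>L x) - ?p)"
      using gamma_map_schwarz[OF \<Phi> x] by (simp add: \<Phi>x adj_op_adj_op b)
    \<comment> \<open>A second application of \<open>\<Phi>\<close> replaces \<open>b b\<^sup>*\<close> by \<open>\<Phi>(b b\<^sup>*)\<close> and cancels the constant term.\<close>
    then have "pos_op (\<Phi> (\<Phi> (adj_op x o\<^sub>L x) - ?p))"
      by (intro gamma_map_pos_op[OF \<Phi>] bounded_ops_diff \<Phi>xx_in pq)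
    then have "pos_op (\<Phi> (adj_op x o\<^sub>L x) - \<Phi> ?p)"
      by (simp add: gamma_map_diff[OF \<Phi> \<Phi>xx_in pq(1)] idem xx_in)
    then have "cinner ((\<Phi> (adj_op x o\<^sub>L x) - \<Phi> ?p) \<xi>) \<xi> \<in> \<real>\<^sub>\<ge>\<^sub>0"
      by (simp add: pos_op_def)
    moreover have "cinner ((\<Phi> (adj_op x o\<^sub>L x) - \<Phi> ?p) \<xi>) \<xi> = z * c + cnj z * cnj c + z * cnj z * d"
      unfolding \<Phi>xx c_def d_def
      using cinner_commute[of \<xi> "\<Phi> (b o\<^sub>L w) \<xi>"]
      by (simp add: blinfun.add_left blinfun.diff_left scale_op.rep_eq cinner_linear
          cinner_adj_op_left[OF \<Phi>bw])
    ultimately show ?thesis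
      by (simp add: complex_nonneg_Reals_iff)
  qed
  have "(cmod c)\<^sup>2 = 0"
  proof (rule eq_0_if_quadratic_nonneg)
    fix t :: real
    \<comment> \<open>The choice \<open>z = t c\<^sup>*\<close> turns the first-order part into \<open>2 t \<bar>c\<bar>\<^sup>2\<close>.\<close>
    have cc: "c * cnj c = of_real ((cmod c)\<^sup>2)"
      by (rule complex_norm_square[symmetric])
    have "of_real t * cnj c * c + cnj (of_real t * cnj c) * cnj c
        + of_real t * cnj c * cnj (of_real t * cnj c) * d
      = of_real (2 * t) * (c * cnj c) + of_real (t\<^sup>2) * (c * cnj c) * d"
      by (simp add: algebra_simps power2_eq_square)
    also have "Re \<dots> = 2 * t * (cmod c)\<^sup>2 + t\<^sup>2 * ((cmod c)\<^sup>2 * Re d)"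
      unfolding cc by simp
    finally show "0 \<le> 2 * t * (cmod c)\<^sup>2 + t\<^sup>2 * ((cmod c)\<^sup>2 * Re d)"
      using pos[of "of_real t * cnj c"] by simp
  qed
  then show "cinner (\<Phi> (b o\<^sub>L w) \<xi>) \<xi> = 0"
    by (simp add: c_def)
qed

lemma idempotent_gamma_map_left_kernel:
  fixes \<Phi> :: "('h::complex_hilbert \<Rightarrow>\<^sub>L 'h) \<Rightarrow> ('h \<Rightarrow>\<^sub>L 'h)"
  assumes \<Phi>: "gamma_map G \<pi> bounded_ops bounded_ops \<Phi>"
    and idem: "\<And>x. x \<in> bounded_ops \<Longrightarrow> \<Phi> (\<Phi> x) = \<Phi> x"
    and b: "b \<in> bounded_ops" "\<Phi> b = b" and w: "w \<in> bounded_ops" "\<Phi> w = 0"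
  shows "\<Phi> (w o\<^sub>L b) = 0"
proof -
  have "\<Phi> (adj_op b o\<^sub>L adj_op w) = 0"
    using b w by (intro idempotent_gamma_map_right_kernel[OF \<Phi> idem])
      (simp_all add: adj_op_bounded_ops gamma_map_adj[OF \<Phi>])
  then have "adj_op (\<Phi> (w o\<^sub>L b)) = 0"
    using b w by (simp add: gamma_map_adj[OF \<Phi>, symmetric] adj_op_compose bounded_ops_compose)
  then show ?thesis
    using adj_op_adj_op[of "\<Phi> (w o\<^sub>L b)"] gamma_mapD(1)[OF \<Phi>, of "w o\<^sub>L b"] b w
    by (simp add: bounded_ops_compose)
qed


section \<open>Extendable traces\<close>

theorem theorem6p3:
  fixes G :: "('g, 'm) monoid_scheme"
    and \<pi> :: "'g \<Rightarrow> ('h::complex_hilbert \<Rightarrow>\<^sub>L 'h)"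
    and \<phi> :: "('h \<Rightarrow>\<^sub>L 'h) \<Rightarrow> ('h \<Rightarrow>\<^sub>L 'h)"
    and \<tau> :: "('h \<Rightarrow>\<^sub>L 'h) \<Rightarrow> complex"
  assumes "group G"
    and "\<pi> \<in> hom G unitary_group"
    and "minimal_gamma_map G \<pi> \<phi>"
    and "fh_commutative \<phi>"
    and "trace_on (cstar_rep G \<pi>) \<tau>"
    and "extendable G \<pi> \<phi> \<tau>"
  shows "\<forall>g \<in> carrier G - amenable_radical G \<pi> \<phi>. \<tau> (\<pi> g) = 0"
proof (rule ballI, rule ccontr)
  fix g assume g: "g \<in> carrier G - amenable_radical G \<pi> \<phi>" and \<tau>g: "\<tau> (\<pi> g) \<noteq> 0"
  interpret G: group G by (rule assms(1))
  have \<phi>: "gamma_map G \<pi> bounded_ops bounded_ops \<phi>"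
    using assms(3) by (simp add: minimal_gamma_map_def)
  have sub: "fh_boundary \<phi> \<subseteq> bounded_ops"
    using gamma_mapD(1)[OF \<phi>] by (auto simp: fh_boundary_def)
  obtain \<Phi> where \<Phi>B: "gamma_map G \<pi> bounded_ops (fh_boundary \<phi>) \<Phi>"
    and ext: "\<And>a. a \<in> cstar_rep G \<pi> \<Longrightarrow> \<Phi> a = scale_op (\<tau> a) id_blinfun"
    using assms(6) by (auto simp: extendable_def)
  have \<Phi>: "gamma_map G \<pi> bounded_ops bounded_ops \<Phi>"
    by (rule gamma_map_mono_codomain[OF \<Phi>B sub])
  have fixed: "\<Phi> b = b" if "b \<in> fh_boundary \<phi>" for b
    by (rule gamma_map_to_boundary_fixes_boundary[OF assms(1-3) \<Phi>B that])
  have idem: "\<Phi> (\<Phi> x) = \<Phi> x" if "x \<in> bounded_ops" for x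
    using fixed gamma_mapD(1)[OF \<Phi>B that] .
  define u where "u = \<pi> g"
  define w where "w = u - scale_op (\<tau> u) id_blinfun"
  have gG: "g \<in> carrier G" using g by blast
  have u: "u \<in> bounded_ops"
    unfolding u_def by (rule hom_unitary_bounded_ops[OF assms(2) gG])
  have w: "w \<in> bounded_ops"
    by (simp add: w_def u bounded_ops_intros)
  have "u \<in> module.span scale_op (\<pi> ` carrier G)"
    unfolding u_def using gG by (intro module.span_base[OF module_scale_op]) simp
  then have "u \<in> cstar_rep G \<pi>"
    unfolding cstar_rep_def using closure_subset by blast
  then have "\<Phi> w = 0"
    by (simp add: w_def ext gamma_map_diff[OF \<Phi>] gamma_mapD(3,4)[OF \<Phi>] u bounded_ops_intros)
  note ker = idempotent_gamma_map_right_kernel[OF \<Phi> idem _ _ w this]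
    idempotent_gamma_map_left_kernel[OF \<Phi> idem _ _ w this]
  have "conj_action G \<pi> g b = b" if b: "b \<in> fh_boundary \<phi>" for b
  proof -
    define b' where "b' = conj_action G \<pi> g b"
    obtain x where x: "x \<in> bounded_ops" "b = \<phi> x"
      using b by (auto simp: fh_boundary_def)
    have "b' = \<phi> (conj_action G \<pi> g x)"
      using gamma_mapD(6)[OF \<phi> gG x(1)] x(2) by (simp add: b'_def)
    then have b': "b' \<in> fh_boundary \<phi>"
      using conj_action_bounded_ops[OF assms(1,2) gG x(1)] by (simp add: fh_boundary_def)
    have bb: "b \<in> bounded_ops" "b' \<in> bounded_ops"
      using b b' sub by blast+
    have "\<pi> (inv\<^bsub>G\<^esub> g) o\<^sub>L \<pi> g = \<pi> \<one>\<^bsub>G\<^esub>"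
      using hom_mult[OF assms(2), of "inv\<^bsub>G\<^esub> g" g] gG by (simp add: unitary_group_def)
    moreover have "\<pi> \<one>\<^bsub>G\<^esub> = id_blinfun"
    proof -
      \<comment> \<open>A surjective idempotent operator is the identity.\<close>
      have idem1: "\<pi> \<one>\<^bsub>G\<^esub> o\<^sub>L \<pi> \<one>\<^bsub>G\<^esub> = \<pi> \<one>\<^bsub>G\<^esub>"
        using hom_mult[OF assms(2), of "\<one>\<^bsub>G\<^esub>" "\<one>\<^bsub>G\<^esub>"] by (simp add: unitary_group_def)
      have "surj (blinfun_apply (\<pi> \<one>\<^bsub>G\<^esub>))"
        using assms(2) G.one_closed unfolding hom_def unitary_group_def by auto
      then show ?thesis
        using idem1 by (intro blinfun_eqI) (metis blinfun_apply_blinfun_compose id_blinfun.rep_eq surjD)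
    qed
    ultimately have inv_g: "\<pi> (inv\<^bsub>G\<^esub> g) (\<pi> g v) = v" for v
      by (metis blinfun_apply_blinfun_compose id_blinfun.rep_eq)
    have "b' o\<^sub>L u = u o\<^sub>L b"
      by (rule blinfun_eqI) (simp add: b'_def u_def conj_action_def inv_g)
    have right: "b' o\<^sub>L u = (b' o\<^sub>L w) + scale_op (\<tau> u) b'"
      by (rule blinfun_eqI) (simp add: w_def blinfun.add_left blinfun.diff_left blinfun.diff_right
          scale_op.rep_eq bounded_opsD[OF bb(2)])
    have left: "u o\<^sub>L b = (w o\<^sub>L b) + scale_op (\<tau> u) b"
      by (rule blinfun_eqI) (simp add: w_def blinfun.add_left blinfun.diff_left scale_op.rep_eq)
    have "scale_op (\<tau> u) b' = \<Phi> (b' o\<^sub>L u)"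
      unfolding right using bb w
      by (simp add: gamma_mapD(2,3)[OF \<Phi>] bounded_ops_intros ker fixed b')
    also have "\<dots> = \<Phi> (u o\<^sub>L b)"
      by (simp add: \<open>b' o\<^sub>L u = u o\<^sub>L b\<close>)
    also have "\<dots> = scale_op (\<tau> u) b"
      unfolding left using bb w
      by (simp add: gamma_mapD(2,3)[OF \<Phi>] bounded_ops_intros ker fixed b)
    finally have "scale_op (inverse (\<tau> u) * \<tau> u) b' = scale_op (inverse (\<tau> u) * \<tau> u) b"
      by (simp add: scale_op_scale_op[symmetric])
    then show "conj_action G \<pi> g b = b"
      using \<tau>g by (simp add: u_def b'_def[symmetric] module.scale_one[OF module_scale_op])
  qed
  then show False
    using g by (auto simp: amenable_radical_def)
qed

end
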